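(* Let $0<\theta\leq1$, let $f\in L^1(\mathbb{R})$, $g\in L^2(\mathbb{R})$ and let $\psi$ be a fractional wavelet. Then for all $a\in\mathbb{R}\setminus\{0\}$ and $b\in\mathbb{R}$, $$\left(W_{f\star\psi}^\theta g\right)(b,a)=\frac{1}{|a|^{\frac{1}{\theta}}}\left(f\left(\frac{\cdot}{(\operatorname{sgn} a)|a|^{\frac{1}{\theta}}}\right)\circ(W_\psi^\theta g)(\cdot,a)\right)(b)$$ and $$\left(W_{f\circ \psi}^\theta g\right)(b,a)=\frac{1}{|a|^{\frac{1}{\theta}}}\left(f\left(\frac{\cdot}{(\operatorname{sgn} a)|a|^{\frac{1}{\theta}}}\right)\star(W_\psi^\theta g)(\cdot,a)\right)(b).$$
   Context: Functions are complex-valued on $\mathbb{R}$. Convolution: $(f\star g)(x)=\int_{\mathbb{R}}f(u)g(x-u)\,du$. Correlation: $(f\circ g)(x)=\int_{\mathbb{R}}\overline{f(u)}g(x+u)\,du$ (whenever the integrals are well-defined). For $0<\theta\leq1$, the fractional Fourier transform is $(\mathfrak{F}_\theta f)(\xi)=\int_{\mathbb{R}}e^{-i(\operatorname{sgn}\xi)|\xi|^{1/\theta}t}f(t)\,dt$. A fractional wavelet (of order $\theta$) is a non-zero function $\psi\in L^1(\mathbb{R})\cap L^2(\mathbb{R})$ with $\int_{\mathbb{R}}\frac{|(\mathfrak{F}_\theta\psi)(\xi)|^2}{|\xi|}\,d\xi<\infty$. For $h\in L^1(\mathbb{R})\cap L^2(\mathbb{R})$ (in particular $h=\psi$, $h=f\star\psi$,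 $h=f\circ\psi$), $a\in\mathbb{R}\setminus\{0\}$ and $b\in\mathbb{R}$, put $h_{a,b,\theta}(t)=\frac{1}{|a|^{1/(2\theta)}}h\left(\frac{t-b}{(\operatorname{sgn} a)|a|^{1/\theta}}\right)$. The continuous fractional wavelet transform (CFrWT) of $g$ with respect to $h$ is $(W_h^\theta g)(b,a)=\int_{\mathbb{R}}g(t)\overline{h_{a,b,\theta}(t)}\,dt$. In the claim the convolution and correlation on the right-hand sides are taken in the variable $b$ with $a$ fixed. *)

theory Defs
  imports "HOL-Analysis.Analysis"
begin

definition L1 :: "(real \<Rightarrow> complex) set" where
  "L1 = {f. integrable lebesgue f}"

definition L2 :: "(real \<Rightarrow> complex) set" where
  "L2 = {f \<in> borel_measurable lebesgue. integrable lebesgue (\<lambda>x. (cmod (f x))\<^sup>2)}"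

definition convolution :: "(real \<Rightarrow> complex) \<Rightarrow> (real \<Rightarrow> complex) \<Rightarrow> real \<Rightarrow> complex"
    (infixl "\<star>" 70) where
  "(f \<star> g) x = (LINT u|lebesgue. f u * g (x - u))"

(* The conjugate falls on the first argument, so the operation is not symmetric. *)
definition correlation :: "(real \<Rightarrow> complex) \<Rightarrow> (real \<Rightarrow> complex) \<Rightarrow> real \<Rightarrow> complex"
    (infixl "\<odot>" 70) where
  "(f \<odot> g) x = (LINT u|lebesgue. cnj (f u) * g (x + u))"

definition frac_fourier :: "real \<Rightarrow> (real \<Rightarrow> complex) \<Rightarrow> real \<Rightarrow> complex" where
  "frac_fourier \<theta> f \<xi> =
     (LINT t|lebesgue. exp (- \<i> * of_real (sgn \<xi> * \<bar>\<xi>\<bar> powr (1 / \<theta>) * t)) * f t)"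

(* "Non-zero" is meant in the sense of L^1 and L^2, i.e. not almost everywhere zero.
   The admissibility integral is taken in [0, \<infinity>], so finiteness is not affected by the
   convention that a non-integrable function has Bochner integral 0. *)
definition frac_wavelet :: "real \<Rightarrow> (real \<Rightarrow> complex) \<Rightarrow> bool" where
  "frac_wavelet \<theta> \<psi> \<longleftrightarrow>
     \<psi> \<in> L1 \<inter> L2 \<and>
     \<not> (AE t in lebesgue. \<psi> t = 0) \<and>
     (\<integral>\<^sup>+ \<xi>. ennreal ((cmod (frac_fourier \<theta> \<psi> \<xi>))\<^sup>2 / \<bar>\<xi>\<bar>) \<partial>lebesgue) < \<infinity>"

definition frac_dilate :: "real \<Rightarrow> (real \<Rightarrow> complex) \<Rightarrow> real \<Rightarrow> real \<Rightarrow> real \<Rightarrow> complex" where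
  "frac_dilate \<theta> h a b t =
     of_real (1 / \<bar>a\<bar> powr (1 / (2 * \<theta>))) * h ((t - b) / (sgn a * \<bar>a\<bar> powr (1 / \<theta>)))"

definition CFrWT :: "real \<Rightarrow> (real \<Rightarrow> complex) \<Rightarrow> (real \<Rightarrow> complex) \<Rightarrow> real \<Rightarrow> real \<Rightarrow> complex" where
  "CFrWT \<theta> h g b a = (LINT t|lebesgue. g t * cnj (frac_dilate \<theta> h a b t))"

end

theory Submission
  imports Defs
begin

text \<open>With \<open>c = sgn a * \<bar>a\<bar> powr (1 / \<theta>)\<close>, both identities are Fubini's theorem for the kernel
  \<open>(v, t) \<mapsto> F v * g t * cnj (\<psi> ((t - b) / c + s * v))\<close>, where \<open>F = cnj f\<close>, \<open>s = -1\<close> for the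
  convolution and \<open>F = f\<close>, \<open>s = 1\<close> for the correlation, followed by the substitution
  \<open>u = c * v\<close>. The kernel is absolutely
  integrable because \<open>2 |g| |\<psi>| \<le> |g|\<^sup>2 + |\<psi>|\<^sup>2\<close> bounds its \<open>t\<close>-integral by a constant multiple
  of \<open>|F v|\<close>. Lebesgue measurable functions need not be jointly measurable after the affine
  substitution, so Fubini is applied to Borel representatives; every integral involved is
  unchanged, for each value of its parameter, when passing to them.\<close>

lemma measurable_lebesgue_real_affine:
  fixes c t :: real
  assumes "c \<noteq> 0"
  shows "(\<lambda>x. t + c * x) \<in> lebesgue \<rightarrow>\<^sub>M lebesgue"
  using lebesgue_affine_measurable[of "\<lambda>_. c" t] assms by simp

text \<open>Lebesgue measure is its own image under the affine map up to the positive density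
  \<open>\<bar>c\<bar>\<close>, which has no effect on null sets. Hence the preimage of a null set
  is null.\<close>

lemma AE_lebesgue_real_affine:
  fixes c t :: real
  assumes "AE x in lebesgue. P x" and c: "c \<noteq> 0"
  shows "AE x in lebesgue. P (t + c * x)"
proof -
  have "AE x in density (distr lebesgue lebesgue (\<lambda>x. t + c * x)) (\<lambda>_. ennreal \<bar>c\<bar>). P x"
    unfolding lebesgue_real_affine[OF c, of t, symmetric] by (rule assms(1))
  then have "AE x in distr lebesgue lebesgue (\<lambda>x. t + c * x). P x"
    using c by (simp add: AE_density)
  then show ?thesis
    by (rule AE_distrD[OF measurable_lebesgue_real_affine[OF c]])
qed

text \<open>The real-valued version is applied to the real and imaginary parts, and the two
  representatives are recombined.\<close>

lemma completion_ex_borel_measurable_complex: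
  fixes g :: "'a \<Rightarrow> complex"
  assumes "g \<in> borel_measurable (completion M)"
  shows "\<exists>g'\<in>borel_measurable M. AE x in M. g x = g' x"
proof -
  have "(\<lambda>x. Re (g x)) \<in> borel_measurable (completion M)"
    "(\<lambda>x. Im (g x)) \<in> borel_measurable (completion M)"
    using assms by measurable
  from this[THEN completion_ex_borel_measurable_real]
  obtain u v where [measurable]: "u \<in> borel_measurable M" "v \<in> borel_measurable M"
    and ae: "AE x in M. Re (g x) = u x" "AE x in M. Im (g x) = v x"
    by blast
  have "(\<lambda>x. Complex (u x) (v x)) \<in> borel_measurable M"
    unfolding Complex_eq by measurable
  moreover from ae have "AE x in M. g x = Complex (u x) (v x)"
    by eventually_elim (simp add: complex_eq_iff)
  ultimately show ?thesis
    by (intro bexI[where x = "\<lambda>x. Complex (u x) (v x)"])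
qed

lemma lborel_integral_swap_affine_kernel:
  fixes F g h :: "real \<Rightarrow> complex" and c p s :: real
  assumes F: "integrable lborel F"
    and g[measurable]: "g \<in> borel_measurable borel" and h[measurable]: "h \<in> borel_measurable borel"
    and g2: "integrable lborel (\<lambda>x. (cmod (g x))\<^sup>2)"
    and h2: "integrable lborel (\<lambda>x. (cmod (h x))\<^sup>2)"
    and c: "c \<noteq> 0"
  shows "(LINT t|lborel. g t * (LINT v|lborel. F v * h (p + c * t + s * v))) =
    (LINT v|lborel. F v * (LINT t|lborel. g t * h (p + c * t + s * v)))"
proof -
  have Fm[measurable]: "F \<in> borel_measurable borel"
    using borel_measurable_integrable[OF F] by simp
  define k where "k v t = g t * h (p + c * t + s * v)" for v t
  \<comment> \<open>\<open>B v\<close> majorizes \<open>k v\<close>. In \<open>t\<close>, the offset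
    \<open>p + s * v\<close> is a mere translation, so the integral of \<open>B v\<close> is the
    same constant \<open>C\<close> for every \<open>v\<close>; the factor
    \<open>1 / \<bar>c\<bar>\<close> is the Jacobian.\<close>
  define B where "B v t = (cmod (g t))\<^sup>2 + (cmod (h ((p + s * v) + c * t)))\<^sup>2" for v t
  define C where "C = (LINT t|lborel. (cmod (g t))\<^sup>2) + (LINT t|lborel. (cmod (h t))\<^sup>2) / \<bar>c\<bar>"
  have hi: "integrable lborel (\<lambda>t. (cmod (h (q + c * t)))\<^sup>2)" for q
    using lborel_integrable_real_affine[OF h2 c] .
  have Bi: "integrable lborel (B v)" for v
    unfolding B_def by (intro Bochner_Integration.integrable_add g2 hi)
  have BC: "(LINT t|lborel. B v t) = C" for v
    unfolding B_def C_def using lborel_integral_real_affine[OF c, of "\<lambda>t. (cmod (h t))\<^sup>2" "p + s * v"] c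
    by (subst Bochner_Integration.integral_add[OF g2 hi]) simp
  have kB: "cmod (k v t) \<le> B v t" for v t
  proof -
    have "2 * cmod (g t) * cmod (h ((p + s * v) + c * t)) \<le> B v t"
      unfolding B_def by (rule sum_squares_bound)
    moreover have "cmod (k v t) = cmod (g t) * cmod (h ((p + s * v) + c * t))"
      by (simp add: k_def norm_mult add_ac)
    ultimately show ?thesis
      using norm_ge_zero[of "k v t"] by linarith
  qed
  have km[measurable]: "(\<lambda>(v, t). F v * k v t) \<in> borel_measurable (lborel \<Otimes>\<^sub>M lborel)"
    unfolding k_def by measurable
  have kv[measurable]: "k v \<in> borel_measurable lborel" for v
    unfolding k_def by measurable
  have ki: "integrable lborel (k v)" for v
    by (rule Bochner_Integration.integrable_bound[OF Bi]) (auto intro: order_trans[OF kB abs_ge_self])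
  have "integrable (lborel \<Otimes>\<^sub>M lborel) (\<lambda>(v, t). F v * k v t)"
  proof (rule lborel_pair.Fubini_integrable[OF km])
    show "AE v in lborel. integrable lborel (\<lambda>t. case (v, t) of (v, t) \<Rightarrow> F v * k v t)"
      using ki by simp
    have m: "(\<lambda>v. LINT t|lborel. norm (case (v, t) of (v, t) \<Rightarrow> F v * k v t)) \<in> borel_measurable lborel"
      by measurable
    show "integrable lborel (\<lambda>v. LINT t|lborel. norm (case (v, t) of (v, t) \<Rightarrow> F v * k v t))"
    proof (rule Bochner_Integration.integrable_bound[OF _ m])
      show "integrable lborel (\<lambda>v. cmod (F v) * C)"
        using F by simp
      have "(LINT t|lborel. cmod (k v t)) \<le> C" for v
        unfolding BC[symmetric, of v] by (intro integral_mono integrable_norm ki Bi kB)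
      then show "AE v in lborel. norm (LINT t|lborel. norm (case (v, t) of (v, t) \<Rightarrow> F v * k v t))
          \<le> norm (cmod (F v) * C)"
        by (intro always_eventually allI)
          (auto simp: norm_mult abs_mult intro!: mult_left_mono intro: order_trans[OF _ abs_ge_self])
    qed
  qed
  from lborel_pair.Fubini_integral[OF this]
  show ?thesis
    \<comment> \<open>The reversed rule carries the outer factors \<open>g t\<close> and
      \<open>F v\<close> into the inner integrals, where both sides become iterated integrals of one
      kernel.\<close>
    by (simp add: k_def mult.left_commute del: integral_mult_right_zero flip: integral_mult_right_zero)
qed

text \<open>For fixed \<open>t\<close> the argument of \<open>h\<close> is affine in
  \<open>v\<close> with slope \<open>s\<close>, and for fixed \<open>v\<close> affine in
  \<open>t\<close> with slope \<open>c\<close>. Both slopes being nonzero, \<open>h\<close> and its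
  Borel representative agree almost everywhere along every such line, which reduces the claim to the
  Borel case.\<close>

lemma lebesgue_integral_swap_affine_kernel:
  fixes F g h :: "real \<Rightarrow> complex" and c p s :: real
  assumes F: "F \<in> L1" and g: "g \<in> L2" and h: "h \<in> L2" and c: "c \<noteq> 0" and s: "s \<noteq> 0"
  shows "(LINT t|lebesgue. g t * (LINT v|lebesgue. F v * h (p + c * t + s * v))) =
    (LINT v|lebesgue. F v * (LINT t|lebesgue. g t * h (p + c * t + s * v)))"
proof -
  have Fm[measurable]: "F \<in> borel_measurable lebesgue" and gm[measurable]: "g \<in> borel_measurable lebesgue"
    and hm[measurable]: "h \<in> borel_measurable lebesgue"
    using F g h by (auto simp: L1_def L2_def)
  obtain F' where F'b[measurable]: "F' \<in> borel_measurable borel" and F'ae: "AE x in lebesgue. F x = F' x"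
    using completion_ex_borel_measurable_complex[OF Fm] by (auto dest: AE_completion)
  obtain g' where g'b[measurable]: "g' \<in> borel_measurable borel" and g'ae: "AE x in lebesgue. g x = g' x"
    using completion_ex_borel_measurable_complex[OF gm] by (auto dest: AE_completion)
  obtain h' where h'b[measurable]: "h' \<in> borel_measurable borel" and h'ae: "AE x in lebesgue. h x = h' x"
    using completion_ex_borel_measurable_complex[OF hm] by (auto dest: AE_completion)
  have leb: "f \<in> borel_measurable lebesgue" if "f \<in> borel_measurable borel" for f :: "real \<Rightarrow> complex"
    using that by (simp add: measurable_completion)
  note F'm[measurable] = leb[OF F'b] and g'm[measurable] = leb[OF g'b] and h'm[measurable] = leb[OF h'b]
  have F'1: "integrable lborel F'"
  proof -
    have "integrable lebesgue F'"
      using F integrable_cong_AE[OF Fm F'm F'ae] by (simp add: L1_def)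
    then show ?thesis
      by (simp add: integrable_completion)
  qed
  have sq: "integrable lborel (\<lambda>x. (cmod (f' x))\<^sup>2)"
    if "f \<in> L2" "f' \<in> borel_measurable borel" "AE x in lebesgue. f x = f' x" for f f' :: "real \<Rightarrow> complex"
  proof -
    have [measurable]: "f \<in> borel_measurable lebesgue"
      using that(1) by (simp add: L2_def)
    note [measurable] = that(2) leb[OF that(2)]
    from that(3) have "AE x in lebesgue. (cmod (f x))\<^sup>2 = (cmod (f' x))\<^sup>2"
      by eventually_elim simp
    then have "integrable lebesgue (\<lambda>x. (cmod (f x))\<^sup>2) = integrable lebesgue (\<lambda>x. (cmod (f' x))\<^sup>2)"
      by (intro integrable_cong_AE) measurable
    with that(1) have "integrable lebesgue (\<lambda>x. (cmod (f' x))\<^sup>2)"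
      by (simp add: L2_def)
    then show ?thesis
      by (subst (asm) integrable_completion) measurable
  qed
  have comp: "(\<lambda>x. f (q + r * x)) \<in> borel_measurable lebesgue"
    if "f \<in> borel_measurable lebesgue" "r \<noteq> 0" for f :: "real \<Rightarrow> complex" and q r
    by (rule measurable_compose[OF measurable_lebesgue_real_affine[OF that(2)] that(1)])
  have inner: "(LINT x|lebesgue. f x * h (q + r * x)) = (LINT x|lborel. f' x * h' (q + r * x))"
    if f: "f \<in> borel_measurable lebesgue" and f': "f' \<in> borel_measurable borel"
      and ae: "AE x in lebesgue. f x = f' x" and r: "r \<noteq> 0"
    for f f' :: "real \<Rightarrow> complex" and q r
  proof -
    note [measurable] = f f' leb[OF f'] comp[OF hm r] comp[OF h'm r]
    have "(LINT x|lebesgue. f x * h (q + r * x)) = (LINT x|lebesgue. f' x * h' (q + r * x))"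
      using ae AE_lebesgue_real_affine[OF h'ae r, of q] by (intro integral_cong_AE) auto
    also have "\<dots> = (LINT x|lborel. f' x * h' (q + r * x))"
      by (rule integral_completion) measurable
    finally show ?thesis .
  qed
  \<comment> \<open>Once \<open>inner\<close> has been applied, the inner integral is a Borel
    function \<open>H\<close> of its parameter, so only the other factor remains to be
    replaced.\<close>
  have outer: "(LINT x|lebesgue. f x * H x) = (LINT x|lborel. f' x * H x)"
    if f: "f \<in> borel_measurable lebesgue" and f': "f' \<in> borel_measurable borel"
      and ae: "AE x in lebesgue. f x = f' x" and H: "H \<in> borel_measurable borel"
    for f f' H :: "real \<Rightarrow> complex"
  proof -
    note [measurable] = f f' H leb[OF f'] leb[OF H]
    have "(LINT x|lebesgue. f x * H x) = (LINT x|lebesgue. f' x * H x)"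
      using ae by (intro integral_cong_AE) auto
    also have "\<dots> = (LINT x|lborel. f' x * H x)"
      by (rule integral_completion) measurable
    finally show ?thesis .
  qed
  have "(LINT t|lebesgue. g t * (LINT v|lebesgue. F v * h (p + c * t + s * v))) =
      (LINT t|lborel. g' t * (LINT v|lborel. F' v * h' (p + c * t + s * v)))"
    unfolding inner[OF Fm F'b F'ae s] by (rule outer[OF gm g'b g'ae]) measurable
  also have "\<dots> = (LINT v|lborel. F' v * (LINT t|lborel. g' t * h' (p + c * t + s * v)))"
    by (intro lborel_integral_swap_affine_kernel F'1 g'b h'b sq[OF g g'b g'ae] sq[OF h h'b h'ae] c)
  also have "\<dots> = (LINT v|lebesgue. F v * (LINT t|lborel. g' t * h' (p + c * t + s * v)))"
    by (rule outer[OF Fm F'b F'ae, symmetric]) measurable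
  also have "\<dots> = (LINT v|lebesgue. F v * (LINT t|lebesgue. g t * h (p + c * t + s * v)))"
    using inner[OF gm g'b g'ae c, of "p + s * v" for v] by (simp add: add_ac)
  finally show ?thesis .
qed

text \<open>Under \<open>u = c * v\<close> the Jacobian \<open>\<bar>c\<bar>\<close> cancels the
  prefactor; this accounts for the factor in front of the right-hand sides of the theorem.\<close>

lemma lebesgue_integral_scale_first:
  fixes f W :: "real \<Rightarrow> complex" and c :: real
  assumes "c \<noteq> 0"
  shows "of_real (1 / \<bar>c\<bar>) * (LINT u|lebesgue. f (u / c) * W u) = (LINT v|lebesgue. f v * W (c * v))"
  by (subst lebesgue_integral_real_affine[OF assms, of "\<lambda>u. f (u / c) * W u" 0])
    (simp add: assms scaleR_conv_of_real)

theorem theorem3p6: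
  fixes \<theta> :: real and f g \<psi> :: "real \<Rightarrow> complex"
  assumes "0 < \<theta>" and "\<theta> \<le> 1"
    and "f \<in> L1" and "g \<in> L2" and "frac_wavelet \<theta> \<psi>"
  shows "\<forall>a b :: real. a \<noteq> 0 \<longrightarrow>
    CFrWT \<theta> (f \<star> \<psi>) g b a =
      of_real (1 / \<bar>a\<bar> powr (1 / \<theta>)) *
      ((\<lambda>u. f (u / (sgn a * \<bar>a\<bar> powr (1 / \<theta>)))) \<odot> (\<lambda>\<beta>. CFrWT \<theta> \<psi> g \<beta> a)) b \<and>
    CFrWT \<theta> (f \<odot> \<psi>) g b a =
      of_real (1 / \<bar>a\<bar> powr (1 / \<theta>)) *
      ((\<lambda>u. f (u / (sgn a * \<bar>a\<bar> powr (1 / \<theta>)))) \<star> (\<lambda>\<beta>. CFrWT \<theta> \<psi> g \<beta> a)) b"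
proof (intro allI impI)
  fix a b :: real
  assume a: "a \<noteq> 0"
  define c where "c = sgn a * \<bar>a\<bar> powr (1 / \<theta>)"
  define m :: complex where "m = of_real (1 / \<bar>a\<bar> powr (1 / (2 * \<theta>)))"
  have c: "c \<noteq> 0" and abs_c: "\<bar>a\<bar> powr (1 / \<theta>) = \<bar>c\<bar>"
    using a by (auto simp: c_def abs_mult sgn_real_def)
  have cnj_m: "cnj m = m"
    by (simp add: m_def)
  have cnjf: "(\<lambda>x. cnj (f x)) \<in> L1"
    using assms(3) by (simp add: L1_def)
  have cnj\<psi>: "(\<lambda>x. cnj (\<psi> x)) \<in> L2"
    using assms(5) by (simp add: frac_wavelet_def L2_def borel_measurable_complex_iff)
  \<comment> \<open>Left general in \<open>h\<close> because it serves for \<open>\<psi>\<close> as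
    well as for \<open>f \<star> \<psi>\<close> and \<open>f \<odot> \<psi>\<close>.\<close>
  have W: "CFrWT \<theta> h g \<beta> a = m * (LINT t|lebesgue. g t * cnj (h ((t - \<beta>) / c)))" for h \<beta>
    unfolding CFrWT_def frac_dilate_def c_def[symmetric] m_def[symmetric]
    by (simp add: cnj_m mult.left_commute del: integral_mult_right_zero flip: integral_mult_right_zero)
  \<comment> \<open>The key point besides Fubini: shifting the argument of \<open>\<psi>\<close> by
    \<open>s * v\<close> amounts to moving the translation parameter from \<open>b\<close> to
    \<open>b - s * (c * v)\<close>.\<close>
  have swap: "(LINT t|lebesgue. g t * (LINT v|lebesgue. F v * cnj (\<psi> ((t - b) / c + s * v)))) =
      (LINT v|lebesgue. F v * (LINT t|lebesgue. g t * cnj (\<psi> ((t - (b - s * (c * v))) / c))))"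
    if F: "F \<in> L1" and s: "s \<noteq> 0" for F s
  proof -
    have "(t - b) / c + s * v = - b / c + 1 / c * t + s * v"
      and "(t - (b - s * (c * v))) / c = - b / c + 1 / c * t + s * v" for t v
      using c by (simp_all add: field_simps)
    then show ?thesis
      using lebesgue_integral_swap_affine_kernel[OF F assms(4) cnj\<psi> _ s, of "1 / c" "- b / c"] c
      by (simp only:) simp
  qed
  \<comment> \<open>The coefficients \<open>-1\<close> and, below, \<open>1\<close> are kept
    explicit so that the integrals match \<open>swap\<close>.\<close>
  have cnj_conv: "cnj ((f \<star> \<psi>) x) = (LINT u|lebesgue. cnj (f u) * cnj (\<psi> (x + (-1) * u)))" for x
    unfolding convolution_def by (simp del: Bochner_Integration.integral_cnj flip: Bochner_Integration.integral_cnj)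
  have cnj_corr: "cnj ((f \<odot> \<psi>) x) = (LINT u|lebesgue. f u * cnj (\<psi> (x + 1 * u)))" for x
    unfolding correlation_def by (simp del: Bochner_Integration.integral_cnj flip: Bochner_Integration.integral_cnj)
  \<comment> \<open>Here \<open>s = -1\<close> gives the translation \<open>b + c * v\<close> next
    to \<open>cnj (f v)\<close>, the pattern of a correlation; below, \<open>s = 1\<close> gives
    \<open>b - c * v\<close> next to \<open>f v\<close>, that of a convolution. This is why the two
    operations trade places.\<close>
  have "CFrWT \<theta> (f \<star> \<psi>) g b a =
      (LINT v|lebesgue. cnj (f v) * CFrWT \<theta> \<psi> g (b + c * v) a)"
    unfolding W cnj_conv
    by (subst swap[OF cnjf]) (simp_all add: mult.left_commute del: integral_mult_right_zero flip: integral_mult_right_zero)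
  moreover have "CFrWT \<theta> (f \<odot> \<psi>) g b a =
      (LINT v|lebesgue. f v * CFrWT \<theta> \<psi> g (b - c * v) a)"
    unfolding W cnj_corr
    by (subst swap[OF assms(3)]) (simp_all add: mult.left_commute del: integral_mult_right_zero flip: integral_mult_right_zero)
  ultimately show "CFrWT \<theta> (f \<star> \<psi>) g b a =
      of_real (1 / \<bar>a\<bar> powr (1 / \<theta>)) *
      ((\<lambda>u. f (u / (sgn a * \<bar>a\<bar> powr (1 / \<theta>)))) \<odot> (\<lambda>\<beta>. CFrWT \<theta> \<psi> g \<beta> a)) b \<and>
    CFrWT \<theta> (f \<odot> \<psi>) g b a =
      of_real (1 / \<bar>a\<bar> powr (1 / \<theta>)) *
      ((\<lambda>u. f (u / (sgn a * \<bar>a\<bar> powr (1 / \<theta>)))) \<star> (\<lambda>\<beta>. CFrWT \<theta> \<psi> g \<beta> a)) b"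
    unfolding c_def[symmetric] unfolding abs_c
    using lebesgue_integral_scale_first[OF c, of "\<lambda>u. cnj (f u)" "\<lambda>u. CFrWT \<theta> \<psi> g (b + u) a"]
      lebesgue_integral_scale_first[OF c, of f "\<lambda>u. CFrWT \<theta> \<psi> g (b - u) a"]
    by (simp only: correlation_def[of "\<lambda>u. f (u / c)"] convolution_def[of "\<lambda>u. f (u / c)"])
qed

end
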